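(* Let $R$ be a ring, $\sigma$ an endomorphism of $R$ and $\delta$ a $\sigma$-derivation of $R$. Suppose that $R$ is $(\sigma,\delta)$-skew Armendariz and satisfies the condition $(\mathcal{C}_{\sigma})$. Then: (1) $R$ is reversible if and only if $R[x;\sigma,\delta]$ is reversible; (2) $R$ is symmetric if and only if $R[x;\sigma,\delta]$ is symmetric.
   Context: Rings are associative with unity, not necessarily commutative. $\sigma$ is a ring endomorphism of $R$. A $\sigma$-derivation is an additive map $\delta:R\to R$ with $\delta(ab)=\sigma(a)\delta(b)+\delta(a)b$ for all $a,b\in R$. The Ore extension $R[x;\sigma,\delta]$ consists of polynomials $\sum a_i x^i$ with coefficients in $R$ written on the left, with usual addition and multiplication determined by $xa=\sigma(a)x+\delta(a)$ for $a\in R$. Condition $(\mathcal{C}_{\sigma})$: whenever $a\sigma(b)=0$ with $a,b\in R$, then $ab=0$. $R$ is $(\sigma,\delta)$-skew Armendariz if for all $p=\sum_{i=0}^{n}a_ix^i$ and $q=\sum_{j=0}^{m}b_jx^j$ in $R[x;\sigma,\delta]$, $pq=0$ implies $a_ix^ib_jx^j=0$ (in $R[x;\sigma,\delta]$) for all $i,j$. A ring $S$ is reversible if $ab=0$ implies $ba=0$ for all $a,b\in S$; $S$ is symmetric if $abc=0$ implies $acb=0$ for all $a,b,c\in S$. *)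

theory Defs
  imports "HOL-Algebra.UnivPoly"
begin

definition sigma_derivation ::
    "('a, 'm) ring_scheme \<Rightarrow> ('a \<Rightarrow> 'a) \<Rightarrow> ('a \<Rightarrow> 'a) \<Rightarrow> bool" where
  "sigma_derivation R \<sigma> \<delta> \<longleftrightarrow>
     \<delta> \<in> carrier R \<rightarrow> carrier R \<and>
     (\<forall>a \<in> carrier R. \<forall>b \<in> carrier R. \<delta> (a \<oplus>\<^bsub>R\<^esub> b) = \<delta> a \<oplus>\<^bsub>R\<^esub> \<delta> b) \<and>
     (\<forall>a \<in> carrier R. \<forall>b \<in> carrier R.
        \<delta> (a \<otimes>\<^bsub>R\<^esub> b) = \<sigma> a \<otimes>\<^bsub>R\<^esub> \<delta> b \<oplus>\<^bsub>R\<^esub> \<delta> a \<otimes>\<^bsub>R\<^esub> b)"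

text \<open>
  As in \<^const>\<open>UP\<close>, a polynomial is its finitely supported coefficient sequence, with
  coefficients written on the left of the powers of \<open>x\<close>.  Left multiplication by \<open>x\<close> is
  forced by \<open>x b = \<sigma>(b) x + \<delta>(b)\<close>:
  it sends \<open>\<Sum> b\<^sub>n x^n\<close> to \<open>\<Sum> \<sigma>(b\<^sub>n) x^(n+1) + \<Sum> \<delta>(b\<^sub>n) x^n\<close>.
\<close>

definition ore_x_mult ::
    "('a, 'm) ring_scheme \<Rightarrow> ('a \<Rightarrow> 'a) \<Rightarrow> ('a \<Rightarrow> 'a) \<Rightarrow> (nat \<Rightarrow> 'a) \<Rightarrow> nat \<Rightarrow> 'a" where
  "ore_x_mult R \<sigma> \<delta> q =
     (\<lambda>n. (if n = 0 then \<zero>\<^bsub>R\<^esub> else \<sigma> (q (n - 1))) \<oplus>\<^bsub>R\<^esub> \<delta> (q n))"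

text \<open>The product is \<open>(\<Sum> a\<^sub>i x^i) q = \<Sum> a\<^sub>i (x^i q)\<close>.\<close>

definition ore_mult ::
    "('a, 'm) ring_scheme \<Rightarrow> ('a \<Rightarrow> 'a) \<Rightarrow> ('a \<Rightarrow> 'a) \<Rightarrow>
     (nat \<Rightarrow> 'a) \<Rightarrow> (nat \<Rightarrow> 'a) \<Rightarrow> nat \<Rightarrow> 'a" where
  "ore_mult R \<sigma> \<delta> p q =
     (\<lambda>n. \<Oplus>\<^bsub>R\<^esub>i \<in> {..deg R p}. p i \<otimes>\<^bsub>R\<^esub> (ore_x_mult R \<sigma> \<delta> ^^ i) q n)"

text \<open>
  Only the multiplication of the polynomial ring is changed; in particular \<^const>\<open>monom\<close> and
  \<^const>\<open>coeff\<close> are inherited.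
\<close>

definition ore_ext ::
    "('a, 'm) ring_scheme \<Rightarrow> ('a \<Rightarrow> 'a) \<Rightarrow> ('a \<Rightarrow> 'a) \<Rightarrow> ('a, nat \<Rightarrow> 'a) up_ring" where
  "ore_ext R \<sigma> \<delta> = (UP R)\<lparr>mult := ore_mult R \<sigma> \<delta>\<rparr>"

definition cond_C :: "('a, 'm) ring_scheme \<Rightarrow> ('a \<Rightarrow> 'a) \<Rightarrow> bool" where
  "cond_C R \<sigma> \<longleftrightarrow>
     (\<forall>a \<in> carrier R. \<forall>b \<in> carrier R. a \<otimes>\<^bsub>R\<^esub> \<sigma> b = \<zero>\<^bsub>R\<^esub> \<longrightarrow> a \<otimes>\<^bsub>R\<^esub> b = \<zero>\<^bsub>R\<^esub>)"

text \<open>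
  Indices beyond the degrees are harmless below, since the corresponding monomials are zero.
\<close>

definition skew_armendariz ::
    "('a, 'm) ring_scheme \<Rightarrow> ('a \<Rightarrow> 'a) \<Rightarrow> ('a \<Rightarrow> 'a) \<Rightarrow> bool" where
  "skew_armendariz R \<sigma> \<delta> \<longleftrightarrow>
     (let S = ore_ext R \<sigma> \<delta> in
      \<forall>p \<in> carrier S. \<forall>q \<in> carrier S. p \<otimes>\<^bsub>S\<^esub> q = \<zero>\<^bsub>S\<^esub> \<longrightarrow>
        (\<forall>i j. monom S (coeff S p i) i \<otimes>\<^bsub>S\<^esub> monom S (coeff S q j) j = \<zero>\<^bsub>S\<^esub>))"

definition reversible_ring :: "('a, 'm) ring_scheme \<Rightarrow> bool" where
  "reversible_ring S \<longleftrightarrow>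
     (\<forall>a \<in> carrier S. \<forall>b \<in> carrier S. a \<otimes>\<^bsub>S\<^esub> b = \<zero>\<^bsub>S\<^esub> \<longrightarrow> b \<otimes>\<^bsub>S\<^esub> a = \<zero>\<^bsub>S\<^esub>)"

definition symmetric_ring :: "('a, 'm) ring_scheme \<Rightarrow> bool" where
  "symmetric_ring S \<longleftrightarrow>
     (\<forall>a \<in> carrier S. \<forall>b \<in> carrier S. \<forall>c \<in> carrier S.
        a \<otimes>\<^bsub>S\<^esub> b \<otimes>\<^bsub>S\<^esub> c = \<zero>\<^bsub>S\<^esub> \<longrightarrow> a \<otimes>\<^bsub>S\<^esub> c \<otimes>\<^bsub>S\<^esub> b = \<zero>\<^bsub>S\<^esub>)"

text \<open>
  Sanity check: \<^const>\<open>ore_ext\<close> is a ring containing the constants \<open>R\<close>, the product of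
  \<open>a x^i\<close> and \<open>x^j\<close> is \<open>a x^(i+j)\<close>, and \<open>x a = \<sigma>(a) x + \<delta>(a)\<close>.
\<close>

locale ore_data = ring R for R (structure) +
  fixes \<sigma> \<delta> :: "'a \<Rightarrow> 'a"
  assumes sigma_hom: "\<sigma> \<in> ring_hom R R"
    and delta_der: "sigma_derivation R \<sigma> \<delta>"
begin

abbreviation X :: "(nat \<Rightarrow> 'a) \<Rightarrow> nat \<Rightarrow> 'a" where
  "X \<equiv> ore_x_mult R \<sigma> \<delta>"

abbreviation S where "S \<equiv> ore_ext R \<sigma> \<delta>"

lemma sigma_closed [simp]: "a \<in> carrier R \<Longrightarrow> \<sigma> a \<in> carrier R"
  using sigma_hom by (rule ring_hom_closed)

lemma delta_closed [simp]: "a \<in> carrier R \<Longrightarrow> \<delta> a \<in> carrier R"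
  using delta_der by (auto simp: sigma_derivation_def)

lemma sigma_add: "a \<in> carrier R \<Longrightarrow> b \<in> carrier R \<Longrightarrow> \<sigma> (a \<oplus> b) = \<sigma> a \<oplus> \<sigma> b"
  using sigma_hom by (rule ring_hom_add)

lemma sigma_mult: "a \<in> carrier R \<Longrightarrow> b \<in> carrier R \<Longrightarrow> \<sigma> (a \<otimes> b) = \<sigma> a \<otimes> \<sigma> b"
  using sigma_hom by (rule ring_hom_mult)

lemma sigma_one [simp]: "\<sigma> \<one> = \<one>"
  using sigma_hom by (rule ring_hom_one)

lemma sigma_zero [simp]: "\<sigma> \<zero> = \<zero>"
  using sigma_add[of \<zero> \<zero>] by simp

lemma delta_add: "a \<in> carrier R \<Longrightarrow> b \<in> carrier R \<Longrightarrow> \<delta> (a \<oplus> b) = \<delta> a \<oplus> \<delta> b"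
  using delta_der by (auto simp: sigma_derivation_def)

lemma delta_mult:
  "a \<in> carrier R \<Longrightarrow> b \<in> carrier R \<Longrightarrow> \<delta> (a \<otimes> b) = \<sigma> a \<otimes> \<delta> b \<oplus> \<delta> a \<otimes> b"
  using delta_der by (auto simp: sigma_derivation_def)

lemma delta_zero [simp]: "\<delta> \<zero> = \<zero>"
  using delta_add[of \<zero> \<zero>] by simp

lemma delta_one [simp]: "\<delta> \<one> = \<zero>"
  using delta_mult[of \<one> \<one>] by simp

lemma sigma_finsum:
  "f \<in> A \<rightarrow> carrier R \<Longrightarrow> finite A \<Longrightarrow> \<sigma> (\<Oplus>i \<in> A. f i) = (\<Oplus>i \<in> A. \<sigma> (f i))"
  by (induct A rule: infinite_finite_induct) (auto simp: sigma_add Pi_def)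

lemma delta_finsum:
  "f \<in> A \<rightarrow> carrier R \<Longrightarrow> finite A \<Longrightarrow> \<delta> (\<Oplus>i \<in> A. f i) = (\<Oplus>i \<in> A. \<delta> (f i))"
  by (induct A rule: infinite_finite_induct) (auto simp: delta_add Pi_def)

lemma up_zero_above:
  assumes "p \<in> up R" "deg R p < n" shows "p n = \<zero>"
proof -
  interpret UP_ring R "UP R" by unfold_locales
  show ?thesis using deg_aboveD[of p n] assms by (simp add: UP_def)
qed

lemma deg_le:
  assumes "p \<in> up R" "\<And>n. N < n \<Longrightarrow> p n = \<zero>" shows "deg R p \<le> N"
proof -
  interpret UP_ring R "UP R" by unfold_locales
  show ?thesis using assms by (intro deg_aboveI) (auto simp: UP_def)
qed

lemma upI: "(\<And>n. f n \<in> carrier R) \<Longrightarrow> (\<And>n. N < n \<Longrightarrow> f n = \<zero>) \<Longrightarrow> f \<in> up R"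
  by (auto simp: up_def bound_def)

lemma upC [simp]: "p \<in> up R \<Longrightarrow> p n \<in> carrier R"
  by (rule mem_upD)

lemma finsum_cut:
  assumes "\<And>i. f i \<in> carrier R" "\<And>i. M < i \<Longrightarrow> f i = \<zero>" "M \<le> N"
  shows "(\<Oplus>i \<in> {..M}. f i) = (\<Oplus>i \<in> {..N::nat}. f i)"
  using assms by (intro add.finprod_mono_neutral_cong_left) auto

lemma finsum_single:
  assumes "\<And>i. f i \<in> carrier R" "\<And>i. i \<noteq> M \<Longrightarrow> f i = \<zero>" "M \<le> N"
  shows "(\<Oplus>i \<in> {..N::nat}. f i) = f M"
proof -
  have "(\<Oplus>i \<in> {M}. f i) = (\<Oplus>i \<in> {..N}. f i)"
    using assms by (intro add.finprod_mono_neutral_cong_left) auto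
  then show ?thesis using assms by simp
qed

lemma finsum_swap:
  assumes "\<And>i j. f i j \<in> carrier R"
  shows "(\<Oplus>i \<in> {..M::nat}. \<Oplus>j \<in> {..N::nat}. f i j) = (\<Oplus>j \<in> {..N}. \<Oplus>i \<in> {..M}. f i j)"
  by (induct M) (simp_all add: assms finsum_addf)

lemma X_up [simp]: assumes "q \<in> up R" shows "X q \<in> up R"
  by (rule upI[of _ "Suc (deg R q)"])
     (use assms up_zero_above[OF assms] in \<open>auto simp: ore_x_mult_def\<close>)

lemma Xn_up [simp]: "q \<in> up R \<Longrightarrow> (X ^^ i) q \<in> up R"
  by (induct i) auto

lemma X_add:
  assumes "p \<in> up R" "q \<in> up R" shows "X (\<lambda>n. p n \<oplus> q n) = (\<lambda>n. X p n \<oplus> X q n)"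
  by (rule ext) (use assms in \<open>auto simp: ore_x_mult_def sigma_add delta_add a_ac\<close>)

lemma Xn_add:
  "p \<in> up R \<Longrightarrow> q \<in> up R \<Longrightarrow>
     (X ^^ i) (\<lambda>n. p n \<oplus> q n) = (\<lambda>n. (X ^^ i) p n \<oplus> (X ^^ i) q n)"
  by (induct i) (simp_all add: X_add)

lemma ore_mult_eq:
  assumes "p \<in> up R" "q \<in> up R" "\<And>n. N < n \<Longrightarrow> p n = \<zero>"
  shows "ore_mult R \<sigma> \<delta> p q n = (\<Oplus>i \<in> {..N}. p i \<otimes> (X ^^ i) q n)"
proof -
  have "deg R p \<le> N" using assms by (intro deg_le)
  then show ?thesis unfolding ore_mult_def
    by (intro finsum_cut) (use assms up_zero_above[OF assms(1)] in auto)
qed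

lemma ore_mult_up [simp]:
  assumes "p \<in> up R" "q \<in> up R" shows "ore_mult R \<sigma> \<delta> p q \<in> up R"
proof (rule upI)
  fix n show "ore_mult R \<sigma> \<delta> p q n \<in> carrier R"
    unfolding ore_mult_def using assms by (intro finsum_closed) auto
next
  define M where "M = Max ((\<lambda>i. deg R ((X ^^ i) q)) ` {..deg R p})"
  fix n assume n: "M < n"
  have "(X ^^ i) q n = \<zero>" if "i \<le> deg R p" for i
  proof -
    have "deg R ((X ^^ i) q) \<le> M" unfolding M_def using that by (intro Max_ge) auto
    then show ?thesis using n up_zero_above[of "(X ^^ i) q" n] assms by simp
  qed
  then have "ore_mult R \<sigma> \<delta> p q n = (\<Oplus>i \<in> {..deg R p}. \<zero>)"
    unfolding ore_mult_def using assms by (intro finsum_cong') auto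
  then show "ore_mult R \<sigma> \<delta> p q n = \<zero>" by simp
qed

lemma X_mult:
  assumes "q \<in> up R" "r \<in> up R"
  shows "X (ore_mult R \<sigma> \<delta> q r) = ore_mult R \<sigma> \<delta> (X q) r"
proof
  fix n
  define N where "N = deg R q"
  have qN: "q i = \<zero>" if "N < i" for i
    using that up_zero_above[OF assms(1)] by (simp add: N_def)
  let ?s = "\<lambda>i. \<Oplus>j \<in> {..N}. q j \<otimes> (X ^^ j) r i"
  have L: "ore_mult R \<sigma> \<delta> q r = ?s"
    using ore_mult_eq[OF assms qN] by blast
  have 1: "(if n = 0 then \<zero> else \<sigma> (?s (n - 1))) =
      (\<Oplus>j \<in> {..N}. \<sigma> (q j) \<otimes> (if n = 0 then \<zero> else \<sigma> ((X ^^ j) r (n - 1))))"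
    using assms by (auto simp: sigma_finsum sigma_mult Pi_def cong: finsum_cong)
  have 2: "\<delta> (?s n) =
      (\<Oplus>j \<in> {..N}. \<sigma> (q j) \<otimes> \<delta> ((X ^^ j) r n) \<oplus> \<delta> (q j) \<otimes> (X ^^ j) r n)"
    using assms by (simp add: delta_finsum delta_mult Pi_def cong: finsum_cong)
  have "X (ore_mult R \<sigma> \<delta> q r) n =
      (\<Oplus>j \<in> {..N}. \<sigma> (q j) \<otimes> (if n = 0 then \<zero> else \<sigma> ((X ^^ j) r (n - 1)))) \<oplus>
      (\<Oplus>j \<in> {..N}. \<sigma> (q j) \<otimes> \<delta> ((X ^^ j) r n) \<oplus> \<delta> (q j) \<otimes> (X ^^ j) r n)"
    unfolding L by (subst ore_x_mult_def) (simp only: 1 2)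
  also have "\<dots> = (\<Oplus>j \<in> {..N}. \<sigma> (q j) \<otimes> (if n = 0 then \<zero> else \<sigma> ((X ^^ j) r (n - 1))) \<oplus>
      (\<sigma> (q j) \<otimes> \<delta> ((X ^^ j) r n) \<oplus> \<delta> (q j) \<otimes> (X ^^ j) r n))"
    using assms by (subst finsum_addf) auto
  also have "\<dots> = (\<Oplus>j \<in> {..N}. \<sigma> (q j) \<otimes> (X ^^ Suc j) r n \<oplus> \<delta> (q j) \<otimes> (X ^^ j) r n)"
  proof (rule finsum_cong')
    fix j assume "j \<in> {..N}"
    show "\<sigma> (q j) \<otimes> (if n = 0 then \<zero> else \<sigma> ((X ^^ j) r (n - 1))) \<oplus>
        (\<sigma> (q j) \<otimes> \<delta> ((X ^^ j) r n) \<oplus> \<delta> (q j) \<otimes> (X ^^ j) r n) =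
        \<sigma> (q j) \<otimes> (X ^^ Suc j) r n \<oplus> \<delta> (q j) \<otimes> (X ^^ j) r n"
      using assms ore_x_mult_def[of R \<sigma> \<delta> "(X ^^ j) r"] by (simp add: r_distr a_assoc)
  qed (use assms X_up[OF Xn_up[OF assms(2)]] in auto)
  also have "\<dots> = (\<Oplus>j \<in> {..N}. \<sigma> (q j) \<otimes> (X ^^ Suc j) r n) \<oplus>
      (\<Oplus>j \<in> {..N}. \<delta> (q j) \<otimes> (X ^^ j) r n)"
    using assms X_up[OF Xn_up[OF assms(2)]] by (subst finsum_addf) auto
  also have "(\<Oplus>j \<in> {..N}. \<sigma> (q j) \<otimes> (X ^^ Suc j) r n) =
      (\<Oplus>j \<in> {..Suc N}. (if j = 0 then \<zero> else \<sigma> (q (j - 1))) \<otimes> (X ^^ j) r n)"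
    by (subst finsum_Suc2) (use assms X_up[OF Xn_up[OF assms(2)]] in auto)
  also have "(\<Oplus>j \<in> {..N}. \<delta> (q j) \<otimes> (X ^^ j) r n) =
      (\<Oplus>j \<in> {..Suc N}. \<delta> (q j) \<otimes> (X ^^ j) r n)"
    by (rule finsum_cut) (use assms qN in auto)
  also have "(\<Oplus>j \<in> {..Suc N}. (if j = 0 then \<zero> else \<sigma> (q (j - 1))) \<otimes> (X ^^ j) r n) \<oplus>
      (\<Oplus>j \<in> {..Suc N}. \<delta> (q j) \<otimes> (X ^^ j) r n) =
      (\<Oplus>j \<in> {..Suc N}. (if j = 0 then \<zero> else \<sigma> (q (j - 1))) \<otimes> (X ^^ j) r n \<oplus>
        \<delta> (q j) \<otimes> (X ^^ j) r n)"
    by (rule finsum_addf[symmetric]) (use assms in auto)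
  also have "\<dots> = (\<Oplus>j \<in> {..Suc N}. X q j \<otimes> (X ^^ j) r n)"
    by (rule finsum_cong')
       (use assms ore_x_mult_def[of R \<sigma> \<delta> q] in \<open>auto simp: l_distr\<close>)
  also have "\<dots> = ore_mult R \<sigma> \<delta> (X q) r n"
  proof (rule ore_mult_eq[symmetric])
    show "X q i = \<zero>" if "Suc N < i" for i
      using that qN by (simp add: ore_x_mult_def)
  qed (use assms in auto)
  finally show "X (ore_mult R \<sigma> \<delta> q r) n = ore_mult R \<sigma> \<delta> (X q) r n" .
qed

lemma Xn_mult:
  "q \<in> up R \<Longrightarrow> r \<in> up R \<Longrightarrow>
     (X ^^ k) (ore_mult R \<sigma> \<delta> q r) = ore_mult R \<sigma> \<delta> ((X ^^ k) q) r"
  by (induct k) (simp_all add: X_mult)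

lemma ore_mult_assoc:
  assumes "p \<in> up R" "q \<in> up R" "r \<in> up R"
  shows "ore_mult R \<sigma> \<delta> (ore_mult R \<sigma> \<delta> p q) r = ore_mult R \<sigma> \<delta> p (ore_mult R \<sigma> \<delta> q r)"
proof
  fix n
  define K where "K = deg R p"
  define N where "N = Max (insert (deg R (ore_mult R \<sigma> \<delta> p q))
    ((\<lambda>k. deg R ((X ^^ k) q)) ` {..K}))"
  have N1: "ore_mult R \<sigma> \<delta> p q i = \<zero>" if "N < i" for i
  proof -
    have "deg R (ore_mult R \<sigma> \<delta> p q) \<le> N" unfolding N_def by (intro Max_ge) auto
    then show ?thesis using that up_zero_above assms by simp
  qed
  have N2: "(X ^^ k) q i = \<zero>" if "k \<le> K" "N < i" for k i
  proof -
    have "deg R ((X ^^ k) q) \<le> N" unfolding N_def using that by (intro Max_ge) auto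
    then show ?thesis using that up_zero_above[of "(X ^^ k) q" i] assms by simp
  qed
  have "ore_mult R \<sigma> \<delta> (ore_mult R \<sigma> \<delta> p q) r n =
      (\<Oplus>i \<in> {..N}. ore_mult R \<sigma> \<delta> p q i \<otimes> (X ^^ i) r n)"
    by (rule ore_mult_eq) (use assms N1 in auto)
  also have "\<dots> = (\<Oplus>i \<in> {..N}. \<Oplus>k \<in> {..K}. p k \<otimes> ((X ^^ k) q i \<otimes> (X ^^ i) r n))"
    using assms
    by (simp add: ore_mult_def finsum_ldistr m_assoc K_def Pi_def cong: finsum_cong)
  also have "\<dots> = (\<Oplus>k \<in> {..K}. \<Oplus>i \<in> {..N}. p k \<otimes> ((X ^^ k) q i \<otimes> (X ^^ i) r n))"
    by (rule finsum_swap) (use assms in auto)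
  also have "\<dots> = (\<Oplus>k \<in> {..K}. p k \<otimes> ore_mult R \<sigma> \<delta> ((X ^^ k) q) r n)"
  proof (rule finsum_cong')
    fix k assume "k \<in> {..K}"
    then show "(\<Oplus>i \<in> {..N}. p k \<otimes> ((X ^^ k) q i \<otimes> (X ^^ i) r n)) =
        p k \<otimes> ore_mult R \<sigma> \<delta> ((X ^^ k) q) r n"
      using assms ore_mult_eq[of "(X ^^ k) q" r N n] N2 by (simp add: finsum_rdistr Pi_def)
  qed (use assms in auto)
  also have "\<dots> = ore_mult R \<sigma> \<delta> p (ore_mult R \<sigma> \<delta> q r) n"
    using assms by (simp add: ore_mult_def[of R \<sigma> \<delta> p] Xn_mult K_def)
  finally show "ore_mult R \<sigma> \<delta> (ore_mult R \<sigma> \<delta> p q) r n =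
      ore_mult R \<sigma> \<delta> p (ore_mult R \<sigma> \<delta> q r) n" .
qed

abbreviation xpow :: "'a \<Rightarrow> nat \<Rightarrow> nat \<Rightarrow> 'a" where
  "xpow a n \<equiv> (\<lambda>i. if i = n then a else \<zero>)"

lemma xpow_up [simp]: "a \<in> carrier R \<Longrightarrow> xpow a n \<in> up R"
  by (rule upI[of _ n]) auto

lemma xpow_mult:
  assumes "a \<in> carrier R" "q \<in> up R"
  shows "ore_mult R \<sigma> \<delta> (xpow a k) q = (\<lambda>n. a \<otimes> (X ^^ k) q n)"
proof
  fix n
  have "ore_mult R \<sigma> \<delta> (xpow a k) q n = (\<Oplus>i \<in> {..k}. xpow a k i \<otimes> (X ^^ i) q n)"
    by (rule ore_mult_eq) (use assms in auto)
  also have "\<dots> = xpow a k k \<otimes> (X ^^ k) q n"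
    by (rule finsum_single[where f = "\<lambda>i. xpow a k i \<otimes> (X ^^ i) q n"]) (use assms in auto)
  finally show "ore_mult R \<sigma> \<delta> (xpow a k) q n = a \<otimes> (X ^^ k) q n" by simp
qed

lemma X_xpow_one: "X (xpow \<one> j) = xpow \<one> (Suc j)"
  by (rule ext) (auto simp: ore_x_mult_def)

lemma Xn_xpow_one: "(X ^^ k) (xpow \<one> j) = xpow \<one> (k + j)"
  by (induct k) (simp_all add: X_xpow_one)

lemma ore_mult_one:
  assumes "p \<in> up R" shows "ore_mult R \<sigma> \<delta> p (xpow \<one> 0) = p"
proof
  fix n
  let ?N = "max n (deg R p)"
  have "ore_mult R \<sigma> \<delta> p (xpow \<one> 0) n = (\<Oplus>i \<in> {..?N}. p i \<otimes> (X ^^ i) (xpow \<one> 0) n)"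
    by (rule ore_mult_eq) (use assms up_zero_above[OF assms] in auto)
  also have "\<dots> = p n \<otimes> (X ^^ n) (xpow \<one> 0) n"
    by (rule finsum_single[where f = "\<lambda>i. p i \<otimes> (X ^^ i) (xpow \<one> 0) n"])
       (use assms in \<open>auto simp: Xn_xpow_one\<close>)
  finally show "ore_mult R \<sigma> \<delta> p (xpow \<one> 0) n = p n"
    using assms by (simp add: Xn_xpow_one)
qed

lemma ore_mult_add_right:
  assumes "p \<in> up R" "q \<in> up R" "r \<in> up R"
  shows "ore_mult R \<sigma> \<delta> p (\<lambda>n. q n \<oplus> r n) =
         (\<lambda>n. ore_mult R \<sigma> \<delta> p q n \<oplus> ore_mult R \<sigma> \<delta> p r n)"
  using assms
  by (simp add: ore_mult_def Xn_add r_distr finsum_addf Pi_def fun_eq_iff cong: finsum_cong)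

lemma ore_mult_add_left:
  assumes "p \<in> up R" "q \<in> up R" "r \<in> up R"
  shows "ore_mult R \<sigma> \<delta> (\<lambda>n. p n \<oplus> q n) r =
         (\<lambda>n. ore_mult R \<sigma> \<delta> p r n \<oplus> ore_mult R \<sigma> \<delta> q r n)"
proof
  fix n
  define N where "N = max (deg R p) (deg R q)"
  have N: "p i = \<zero>" "q i = \<zero>" if "N < i" for i
    using that up_zero_above assms by (auto simp: N_def)
  have "ore_mult R \<sigma> \<delta> (\<lambda>n. p n \<oplus> q n) r n =
      (\<Oplus>i \<in> {..N}. (p i \<oplus> q i) \<otimes> (X ^^ i) r n)"
    by (rule ore_mult_eq) (use assms N up_add_closed in auto)
  also have "\<dots> = ore_mult R \<sigma> \<delta> p r n \<oplus> ore_mult R \<sigma> \<delta> q r n"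
    using assms N
    by (simp add: ore_mult_eq[where N = N] l_distr finsum_addf Pi_def cong: finsum_cong)
  finally show "ore_mult R \<sigma> \<delta> (\<lambda>n. p n \<oplus> q n) r n =
      ore_mult R \<sigma> \<delta> p r n \<oplus> ore_mult R \<sigma> \<delta> q r n" .
qed

lemma ore_ext_simps [simp]:
  "carrier S = up R" "mult S = ore_mult R \<sigma> \<delta>" "one S = xpow \<one> 0" "zero S = (\<lambda>n. \<zero>)"
  "p \<in> up R \<Longrightarrow> q \<in> up R \<Longrightarrow> add S p q = (\<lambda>n. p n \<oplus> q n)"
  "a \<in> carrier R \<Longrightarrow> monom S a k = xpow a k"
  "p \<in> up R \<Longrightarrow> coeff S p = p"
  by (auto simp: ore_ext_def UP_def)

lemma ore_ext_ring: "ring S"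
proof (rule ringI)
  interpret UP_ring R "UP R" by unfold_locales
  have "abelian_group (UP R)" by (rule P.abelian_group_axioms)
  then show "abelian_group S"
    by (simp add: abelian_group_def abelian_monoid_def abelian_group_axioms_def ore_ext_def)
  show "Group.monoid S"
    by (rule monoidI) (simp_all add: ore_mult_assoc ore_mult_one xpow_mult)
qed (simp_all add: ore_mult_add_left ore_mult_add_right)

lemma ore_ext_const_hom: "(\<lambda>a. monom S a 0) \<in> ring_hom R S"
  by (rule ring_hom_memI) (auto simp: xpow_mult)

lemma ore_ext_monom_mult:
  "a \<in> carrier R \<Longrightarrow> monom S a i \<otimes>\<^bsub>S\<^esub> monom S \<one> j = monom S a (i + j)"
  by (auto simp: xpow_mult Xn_xpow_one)

lemma ore_ext_commute:
  "a \<in> carrier R \<Longrightarrow>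
     monom S \<one> 1 \<otimes>\<^bsub>S\<^esub> monom S a 0 = monom S (\<sigma> a) 1 \<oplus>\<^bsub>S\<^esub> monom S (\<delta> a) 0"
  by (auto simp: xpow_mult ore_x_mult_def fun_eq_iff)

end

end

theory Submission
  imports Defs
begin

text \<open>
  The point is that, over a reversible \<open>R\<close>, vanishing of products in the Ore extension does not
  see \<open>\<sigma>\<close> and \<open>\<delta>\<close>: \<open>p q = 0\<close> holds exactly when \<open>p\<^sub>i q\<^sub>j = 0\<close> in \<open>R\<close> for all \<open>i, j\<close>
  (\<open>mult_eq_zero_iff\<close>).

  For one direction, the skew Armendariz property gives \<open>p\<^sub>i x^i q\<^sub>j x^j = 0\<close>.  The leading
  coefficient of this product is \<open>p\<^sub>i \<sigma>^i(q\<^sub>j)\<close>, and condition \<open>C\<^sub>\<sigma>\<close> strips off the powers of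
  \<open>\<sigma>\<close>.  For the other direction, \<open>a b = 0\<close> has to imply \<open>a \<sigma>(b) = 0\<close> and \<open>a \<delta>(b) = 0\<close>, since
  the coefficients of \<open>x^i b\<close> are sums of words in \<open>\<sigma>\<close> and \<open>\<delta>\<close> applied to \<open>b\<close>.  Both follow
  by turning \<open>a b = 0\<close> into \<open>b a = 0\<close>: applying \<open>\<sigma>\<close> gives \<open>\<sigma>(b) \<sigma>(a) = 0\<close>, whence
  \<open>\<sigma>(b) a = 0\<close> by \<open>C\<^sub>\<sigma>\<close>; and multiplying by \<open>x\<close> gives \<open>(\<sigma>(b) x + \<delta>(b)) a = 0\<close>, whence
  \<open>\<delta>(b) a = 0\<close> by the skew Armendariz property.  Reversing once more finishes.

  Associativity upgrades the criterion to three factors: \<open>p q r = 0\<close> exactly when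
  \<open>p\<^sub>i q\<^sub>j r\<^sub>k = 0\<close> for all \<open>i, j, k\<close> (\<open>mult3_eq_zero_iff\<close>).  Through these two criteria
  reversibility and symmetry pass from \<open>R\<close> to the extension, a symmetric ring being reversible
  because it has a unit.  Conversely, both properties pass to \<open>R\<close> because it embeds as the
  subring of constant polynomials.
\<close>

lemma reversible_ring_embed:
  assumes "ring R" "ring S" "h \<in> ring_hom R S" "inj_on h (carrier R)" "reversible_ring S"
  shows "reversible_ring R"
  unfolding reversible_ring_def
proof (intro ballI impI)
  interpret R: ring R by fact
  interpret h: ring_hom_ring R S h using assms by (intro ring_hom_ringI2)
  fix a b assume ab: "a \<in> carrier R" "b \<in> carrier R" "a \<otimes>\<^bsub>R\<^esub> b = \<zero>\<^bsub>R\<^esub>"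
  have "h a \<otimes>\<^bsub>S\<^esub> h b = \<zero>\<^bsub>S\<^esub>"
    using ab by (simp flip: h.hom_mult)
  then have "h (b \<otimes>\<^bsub>R\<^esub> a) = h \<zero>\<^bsub>R\<^esub>"
    using assms(5) ab by (simp add: reversible_ring_def)
  then show "b \<otimes>\<^bsub>R\<^esub> a = \<zero>\<^bsub>R\<^esub>"
    by (rule inj_onD[OF assms(4)]) (use ab in auto)
qed

lemma symmetric_ring_embed:
  assumes "ring R" "ring S" "h \<in> ring_hom R S" "inj_on h (carrier R)" "symmetric_ring S"
  shows "symmetric_ring R"
  unfolding symmetric_ring_def
proof (intro ballI impI)
  interpret R: ring R by fact
  interpret h: ring_hom_ring R S h using assms by (intro ring_hom_ringI2)
  fix a b c
  assume abc: "a \<in> carrier R" "b \<in> carrier R" "c \<in> carrier R"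
    "a \<otimes>\<^bsub>R\<^esub> b \<otimes>\<^bsub>R\<^esub> c = \<zero>\<^bsub>R\<^esub>"
  have "h a \<otimes>\<^bsub>S\<^esub> h b \<otimes>\<^bsub>S\<^esub> h c = \<zero>\<^bsub>S\<^esub>"
    using abc by (simp flip: h.hom_mult)
  then have "h (a \<otimes>\<^bsub>R\<^esub> c \<otimes>\<^bsub>R\<^esub> b) = h \<zero>\<^bsub>R\<^esub>"
    using assms(5) abc by (simp add: symmetric_ring_def)
  then show "a \<otimes>\<^bsub>R\<^esub> c \<otimes>\<^bsub>R\<^esub> b = \<zero>\<^bsub>R\<^esub>"
    by (rule inj_onD[OF assms(4)]) (use abc in auto)
qed

lemma (in ring) symmetric_imp_reversible:
  assumes "symmetric_ring R" shows "reversible_ring R"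
  unfolding reversible_ring_def
proof (intro ballI impI)
  fix a b assume "a \<in> carrier R" "b \<in> carrier R" "a \<otimes> b = \<zero>"
  then have "\<one> \<otimes> b \<otimes> a = \<zero>"
    using assms unfolding symmetric_ring_def by (metis l_one one_closed)
  then show "b \<otimes> a = \<zero>"
    using \<open>b \<in> carrier R\<close> by simp
qed

context ore_data
begin

lemma ore_ext_const_inj: "inj_on (\<lambda>a. monom S a 0) (carrier R)"
  by (rule inj_onI) (auto simp: fun_eq_iff split: if_splits)

lemma cond_C_funpow:
  assumes "cond_C R \<sigma>" "a \<in> carrier R" "b \<in> carrier R" "a \<otimes> (\<sigma> ^^ i) b = \<zero>"
  shows "a \<otimes> b = \<zero>"
proof -
  have closed: "(\<sigma> ^^ i) b \<in> carrier R" for i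
    using assms(3) by (induct i) auto
  show ?thesis
    using assms(4)
  proof (induct i)
    case (Suc i)
    then show ?case
      using assms(1,2) closed[of i] by (simp add: cond_C_def)
  qed simp
qed

text \<open>
  The monomial \<open>\<sigma>^k(b) x^(k+j)\<close> is the leading term of \<open>x^k b x^j\<close>; vanishing above it is
  carried along so that \<open>\<delta>\<close> cannot contribute to the leading coefficient.
\<close>

lemma Xn_xpow_lead:
  assumes "b \<in> carrier R"
  shows "(X ^^ k) (xpow b j) (k + j) = (\<sigma> ^^ k) b \<and> (\<forall>n > k + j. (X ^^ k) (xpow b j) n = \<zero>)"
proof (induct k)
  case (Suc k)
  have "(\<sigma> ^^ k) b \<in> carrier R"
    using assms by (induct k) auto
  then show ?case
    using Suc ore_x_mult_def[of R \<sigma> \<delta> "(X ^^ k) (xpow b j)"] by auto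
qed simp

lemma skew_armendariz_coeff:
  assumes "skew_armendariz R \<sigma> \<delta>" "p \<in> up R" "q \<in> up R"
    "ore_mult R \<sigma> \<delta> p q = (\<lambda>n. \<zero>)"
  shows "p i \<otimes> (X ^^ i) (xpow (q j) j) n = \<zero>"
proof -
  have "ore_mult R \<sigma> \<delta> (xpow (p i) i) (xpow (q j) j) = (\<lambda>n. \<zero>)"
    using assms unfolding skew_armendariz_def Let_def by simp
  then show ?thesis
    using assms by (simp add: xpow_mult fun_eq_iff)
qed

lemma mult_sigma_eq_zero:
  assumes "cond_C R \<sigma>" "reversible_ring R" "a \<in> carrier R" "b \<in> carrier R" "a \<otimes> b = \<zero>"
  shows "a \<otimes> \<sigma> b = \<zero>"
proof -
  have "b \<otimes> a = \<zero>"
    using assms by (simp add: reversible_ring_def)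
  then have "\<sigma> b \<otimes> \<sigma> a = \<zero>"
    using assms sigma_mult[of b a] by simp
  then have "\<sigma> b \<otimes> a = \<zero>"
    using assms by (simp add: cond_C_def)
  then show ?thesis
    using assms by (simp add: reversible_ring_def)
qed

text \<open>
  The derivation rule alone only yields \<open>\<sigma>(b) \<delta>(a) + \<delta>(b) a = 0\<close>; the skew Armendariz property
  of \<open>(x b) a = 0\<close> is what separates the two summands.
\<close>

lemma mult_delta_eq_zero:
  assumes "skew_armendariz R \<sigma> \<delta>" "reversible_ring R"
    "a \<in> carrier R" "b \<in> carrier R" "a \<otimes> b = \<zero>"
  shows "a \<otimes> \<delta> b = \<zero>"
proof -
  have "b \<otimes> a = \<zero>"
    using assms by (simp add: reversible_ring_def)
  then have "ore_mult R \<sigma> \<delta> (xpow b 0) (xpow a 0) = (\<lambda>n. \<zero>)"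
    using assms by (auto simp: xpow_mult)
  then have "ore_mult R \<sigma> \<delta> (X (xpow b 0)) (xpow a 0) = X (\<lambda>n. \<zero>)"
    using assms by (simp flip: X_mult)
  also have "\<dots> = (\<lambda>n. \<zero>)"
    by (auto simp: ore_x_mult_def)
  finally have "X (xpow b 0) 0 \<otimes> (X ^^ 0) (xpow (xpow a 0 0) 0) 0 = \<zero>"
    using assms by (intro skew_armendariz_coeff) auto
  then have "\<delta> b \<otimes> a = \<zero>"
    using assms by (simp add: ore_x_mult_def)
  then show ?thesis
    using assms by (simp add: reversible_ring_def)
qed

lemma mult_Xn_eq_zero:
  assumes "skew_armendariz R \<sigma> \<delta>" "cond_C R \<sigma>" "reversible_ring R"
    "a \<in> carrier R" "q \<in> up R" "\<And>n. a \<otimes> q n = \<zero>"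
  shows "a \<otimes> (X ^^ k) q n = \<zero>"
proof (induct k arbitrary: n)
  case (Suc k)
  then show ?case
    using assms mult_sigma_eq_zero mult_delta_eq_zero ore_x_mult_def[of R \<sigma> \<delta> "(X ^^ k) q"]
    by (simp add: r_distr)
qed (simp add: assms)

theorem mult_eq_zero_iff:
  assumes "skew_armendariz R \<sigma> \<delta>" "cond_C R \<sigma>" "reversible_ring R" "p \<in> up R" "q \<in> up R"
  shows "ore_mult R \<sigma> \<delta> p q = (\<lambda>n. \<zero>) \<longleftrightarrow> (\<forall>i j. p i \<otimes> q j = \<zero>)"
proof (intro iffI allI)
  fix i j assume "ore_mult R \<sigma> \<delta> p q = (\<lambda>n. \<zero>)"
  then have "p i \<otimes> (X ^^ i) (xpow (q j) j) (i + j) = \<zero>"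
    using assms by (intro skew_armendariz_coeff)
  then have "p i \<otimes> (\<sigma> ^^ i) (q j) = \<zero>"
    using assms Xn_xpow_lead[of "q j" i j] by simp
  then show "p i \<otimes> q j = \<zero>"
    using assms by (intro cond_C_funpow[of "p i" "q j" i]) auto
next
  assume "\<forall>i j. p i \<otimes> q j = \<zero>"
  then have "p i \<otimes> (X ^^ i) q n = \<zero>" for i n
    using assms by (intro mult_Xn_eq_zero) auto
  then show "ore_mult R \<sigma> \<delta> p q = (\<lambda>n. \<zero>)"
    by (simp add: ore_mult_def)
qed

text \<open>
  Two applications of the criterion for two factors suffice: \<open>p (q r) = 0\<close> says that the constant
  \<open>p\<^sub>i\<close> kills \<open>q r\<close> for every \<open>i\<close>, and then \<open>(p\<^sub>i q) r = 0\<close> is again a product of two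
  polynomials.
\<close>

theorem mult3_eq_zero_iff:
  assumes "skew_armendariz R \<sigma> \<delta>" "cond_C R \<sigma>" "reversible_ring R"
    "p \<in> up R" "q \<in> up R" "r \<in> up R"
  shows "ore_mult R \<sigma> \<delta> (ore_mult R \<sigma> \<delta> p q) r = (\<lambda>n. \<zero>) \<longleftrightarrow>
    (\<forall>i j k. p i \<otimes> q j \<otimes> r k = \<zero>)"
proof -
  have scale: "(\<lambda>n. a \<otimes> s n) = ore_mult R \<sigma> \<delta> (xpow a 0) s"
    if "a \<in> carrier R" "s \<in> up R" for a s
    using that by (simp add: xpow_mult)
  have "ore_mult R \<sigma> \<delta> (ore_mult R \<sigma> \<delta> p q) r = (\<lambda>n. \<zero>) \<longleftrightarrow>
      (\<forall>i n. p i \<otimes> ore_mult R \<sigma> \<delta> q r n = \<zero>)"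
    using assms by (simp add: ore_mult_assoc mult_eq_zero_iff)
  also have "\<dots> \<longleftrightarrow> (\<forall>i. (\<lambda>n. p i \<otimes> ore_mult R \<sigma> \<delta> q r n) = (\<lambda>n. \<zero>))"
    by (simp add: fun_eq_iff)
  also have "\<dots> \<longleftrightarrow> (\<forall>i. ore_mult R \<sigma> \<delta> (\<lambda>j. p i \<otimes> q j) r = (\<lambda>n. \<zero>))"
    using assms by (simp add: scale ore_mult_assoc)
  also have "\<dots> \<longleftrightarrow> (\<forall>i j k. p i \<otimes> q j \<otimes> r k = \<zero>)"
  proof -
    have "(\<lambda>j. p i \<otimes> q j) \<in> up R" for i
      using assms by (simp add: scale)
    then show ?thesis
      using assms by (simp add: mult_eq_zero_iff)
  qed
  finally show ?thesis .
qed

lemma reversible_ore_ext: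
  assumes "skew_armendariz R \<sigma> \<delta>" "cond_C R \<sigma>" "reversible_ring R"
  shows "reversible_ring S"
  using assms(3) unfolding reversible_ring_def[of S] reversible_ring_def[of R]
  by (simp add: mult_eq_zero_iff[OF assms])

lemma symmetric_ore_ext:
  assumes "skew_armendariz R \<sigma> \<delta>" "cond_C R \<sigma>" "symmetric_ring R"
  shows "symmetric_ring S"
  using assms(3) unfolding symmetric_ring_def[of S] symmetric_ring_def[of R]
  by (simp add: mult3_eq_zero_iff[OF assms(1,2) symmetric_imp_reversible[OF assms(3)]])

end

theorem theorem2p4:
  fixes R :: "('a, 'm) ring_scheme" and \<sigma> \<delta> :: "'a \<Rightarrow> 'a"
  assumes "ring R"
    and "\<sigma> \<in> ring_hom R R"
    and "sigma_derivation R \<sigma> \<delta>"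
    and "skew_armendariz R \<sigma> \<delta>"
    and "cond_C R \<sigma>"
  shows "(reversible_ring R \<longleftrightarrow> reversible_ring (ore_ext R \<sigma> \<delta>)) \<and>
         (symmetric_ring R \<longleftrightarrow> symmetric_ring (ore_ext R \<sigma> \<delta>))"
proof -
  interpret ore_data R \<sigma> \<delta>
    using assms by (simp add: ore_data_def ore_data_axioms_def)
  note embed = assms(1) ore_ext_ring ore_ext_const_hom ore_ext_const_inj
  show ?thesis
    using assms(4,5) reversible_ore_ext symmetric_ore_ext
      reversible_ring_embed[OF embed] symmetric_ring_embed[OF embed] by blast
qed

end
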